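(* Let $X$, $Y$ be Banach spaces. Then $n(\mathcal{A}(X,Y))\leq \min\{n(X^* ),n(Y)\}$.
   Context: Banach spaces are (nonzero) real or complex; $X$ and $Y$ are over the same field. $S_X$ denotes the unit sphere of $X$, $X^*$ its topological dual, and $\mathcal{L}(X)$ the Banach space of bounded linear operators on $X$ with the operator norm. For $T\in\mathcal{L}(X)$ the numerical radius is $v(T)=\sup\{|x^*(Tx)| : x\in S_X,\ x^*\in S_{X^*},\ x^*(x)=1\}$. The numerical index of $X$ is $n(X)=\inf\{v(T): T\in\mathcal{L}(X),\ \|T\|=1\}$. $\mathcal{A}(X,Y)$ is the space of approximable operators from $X$ to $Y$, i.e. operator-norm limits of bounded finite-rank operators, endowed with the operator norm. *)

theory Defs
  imports "HOL-Analysis.Analysis"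
begin

text \<open>
  The scalar field is a type of the following class, i.e. (up to isometric isomorphism) the real
  or the complex numbers.
\<close>

class real_or_complex = real_normed_field +
  assumes real_or_complex_embedding:
    "\<exists>\<phi> :: 'a \<Rightarrow> complex.
       (\<forall>a b. \<phi> (a + b) = \<phi> a + \<phi> b) \<and> (\<forall>a b. \<phi> (a * b) = \<phi> a * \<phi> b) \<and>
       (\<forall>r a. \<phi> (r *\<^sub>R a) = r *\<^sub>R \<phi> a) \<and> (\<forall>a. norm (\<phi> a) = norm a) \<and>
       (range \<phi> = \<real> \<or> range \<phi> = UNIV)"

instance real :: real_or_complex
  by standard
    (rule exI[of _ complex_of_real], auto simp: Reals_def scaleR_conv_of_real)

instance complex :: real_or_complex
  by standard (rule exI[of _ "\<lambda>z. z"], auto)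

text \<open>
  A Banach space over the scalars \<open>'k\<close> is a type of class \<^class>\<open>banach\<close> with a scalar
  multiplication by \<open>'k\<close> which extends the built-in multiplication by real numbers and for which
  the norm is homogeneous.
\<close>

locale normed_space_over = vector_space scale
  for scale :: "'k::real_or_complex \<Rightarrow> 'a::real_normed_vector \<Rightarrow> 'a" +
  assumes scale_of_real: "scale (of_real r) x = r *\<^sub>R x"
    and norm_scale: "norm (scale c x) = norm c * norm x"

text \<open>
  Dual spaces and spaces of operators are subspaces of a type of bounded real-linear maps. The
  notions entering the numerical index are therefore stated for a subspace \<open>V\<close> of a normed type
  (\<open>V = UNIV\<close> for the whole space). Operators on \<open>V\<close> are functions on the type of which only the
  values on \<open>V\<close> matter.
\<close>

definition bounded_linear_on ::
  "('k::real_or_complex \<Rightarrow> 'a::real_normed_vector \<Rightarrow> 'a) \<Rightarrow> 'a set \<Rightarrow>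
   ('k \<Rightarrow> 'b::real_normed_vector \<Rightarrow> 'b) \<Rightarrow> 'b set \<Rightarrow> ('a \<Rightarrow> 'b) \<Rightarrow> bool" where
  "bounded_linear_on s V t W T \<longleftrightarrow>
     T ` V \<subseteq> W \<and>
     (\<forall>x\<in>V. \<forall>y\<in>V. T (x + y) = T x + T y) \<and>
     (\<forall>c. \<forall>x\<in>V. T (s c x) = t c (T x)) \<and>
     (\<exists>B. \<forall>x\<in>V. norm (T x) \<le> B * norm x)"

text \<open>The library's \<^const>\<open>onorm\<close>, relativised to \<open>V\<close>; the quotient is \<open>0\<close> at \<open>x = 0\<close>.\<close>

definition onorm_on :: "'a::real_normed_vector set \<Rightarrow> ('a \<Rightarrow> 'b::real_normed_vector) \<Rightarrow> real" where
  "onorm_on V T = (SUP x\<in>V. norm (T x) / norm x)"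

definition numerical_radius ::
  "('k::real_or_complex \<Rightarrow> 'a::real_normed_vector \<Rightarrow> 'a) \<Rightarrow> 'a set \<Rightarrow> ('a \<Rightarrow> 'a) \<Rightarrow> real" where
  "numerical_radius s V T =
     Sup {norm (f (T x)) | x f. x \<in> V \<and> norm x = 1 \<and>
            bounded_linear_on s V (*) (UNIV :: 'k set) f \<and> onorm_on V f = 1 \<and> f x = 1}"

definition numerical_index ::
  "('k::real_or_complex \<Rightarrow> 'a::real_normed_vector \<Rightarrow> 'a) \<Rightarrow> 'a set \<Rightarrow> real" where
  "numerical_index s V =
     Inf {numerical_radius s V T | T. bounded_linear_on s V s V T \<and> onorm_on V T = 1}"

definition op_scale ::
  "('k::real_or_complex \<Rightarrow> 'b::real_normed_vector \<Rightarrow> 'b) \<Rightarrow>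
   'k \<Rightarrow> ('a::real_normed_vector \<Rightarrow>\<^sub>L 'b) \<Rightarrow> ('a \<Rightarrow>\<^sub>L 'b)" where
  "op_scale t c T = Blinfun (\<lambda>x. t c (blinfun_apply T x))"

text \<open>\<open>Blinfun\<close> is only meaningful on bounded linear arguments, as is the case here.\<close>

lemma (in normed_space_over) blinfun_apply_op_scale:
  "blinfun_apply (op_scale scale c T) x = scale c (blinfun_apply T x)"
proof -
  have comm: "scale c (r *\<^sub>R y) = r *\<^sub>R scale c y" for r y
    by (metis scale_left_commute scale_of_real)
  have "bounded_linear (scale c)"
    by (rule bounded_linear_intro[where K = "norm c"])
      (auto simp: scale_right_distrib comm norm_scale mult.commute)
  from bounded_linear_compose[OF this blinfun.bounded_linear_right]
  have "bounded_linear (\<lambda>x. scale c (blinfun_apply T x))" .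
  then show ?thesis
    by (simp add: op_scale_def bounded_linear_Blinfun_apply)
qed

definition linear_ops ::
  "('k::real_or_complex \<Rightarrow> 'a::real_normed_vector \<Rightarrow> 'a) \<Rightarrow>
   ('k \<Rightarrow> 'b::real_normed_vector \<Rightarrow> 'b) \<Rightarrow> ('a \<Rightarrow>\<^sub>L 'b) set" where
  "linear_ops s t = {T. Vector_Spaces.linear s t (blinfun_apply T)}"

definition dual_space ::
  "('k::real_or_complex \<Rightarrow> 'a::real_normed_vector \<Rightarrow> 'a) \<Rightarrow> ('a \<Rightarrow>\<^sub>L 'k) set" where
  "dual_space s = linear_ops s (*)"

definition finite_rank_ops ::
  "('k::real_or_complex \<Rightarrow> 'a::real_normed_vector \<Rightarrow> 'a) \<Rightarrow>
   ('k \<Rightarrow> 'b::real_normed_vector \<Rightarrow> 'b) \<Rightarrow> ('a \<Rightarrow>\<^sub>L 'b) set" where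
  "finite_rank_ops s t =
     {T \<in> linear_ops s t. \<exists>B. finite B \<and> range (blinfun_apply T) \<subseteq> module.span t B}"

definition approximable_ops ::
  "('k::real_or_complex \<Rightarrow> 'a::real_normed_vector \<Rightarrow> 'a) \<Rightarrow>
   ('k \<Rightarrow> 'b::real_normed_vector \<Rightarrow> 'b) \<Rightarrow> ('a \<Rightarrow>\<^sub>L 'b) set" where
  "approximable_ops s t = closure (finite_rank_ops s t)"

end

theory Submission
  imports Defs
begin

text \<open>
  Write \<open>n\<close> for the numerical index, \<open>v\<close> for the numerical radius and \<open>A(X,Y)\<close> for the approximable
  operators. Each operator \<open>S\<close> of norm one on \<open>Y\<close> or on \<open>X*\<close> is turned into an operator \<open>\<Phi>\<close> of norm
  one on \<open>A(X,Y)\<close> with \<open>v(\<Phi>) \<le> v(S)\<close>; taking infima gives the two inequalities.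

  The numerical radius is controlled by norms alone. For a state \<open>(z, f)\<close> and a scalar \<open>c\<close> whose phase
  is chosen to make \<open>c f(\<Phi> z)\<close> real and nonnegative,
  \<open>1 + |c| |f(\<Phi> z)| = |f(z + c \<Phi> z)| \<le> \<parallel>I + c \<Phi>\<parallel>\<close>. In the other direction (Lumer), applying the
  states at \<open>y\<close> to \<open>(I - c S) y\<close> gives \<open>\<parallel>(I - c S) y\<parallel> \<ge> (1 - |c| v(S)) \<parallel>y\<parallel>\<close>, and \<open>y = (I + c S) x\<close>
  yields \<open>\<parallel>I + c S\<parallel> \<le> (1 + |c|\<^sup>2 \<parallel>S\<parallel>\<^sup>2) / (1 - |c| v(S))\<close>. Hence if \<open>\<parallel>I + c \<Phi>\<parallel> \<le> \<parallel>I + c S\<parallel>\<close> for all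
  scalars \<open>c\<close>, letting \<open>c\<close> tend to \<open>0\<close> gives \<open>v(\<Phi>) \<le> v(S)\<close>. This is
  \<open>numerical_radius_le_transfer\<close>, with the consequence \<open>numerical_index_le_transfer\<close>.

  For \<open>S\<close> on \<open>Y\<close>, take \<open>\<Phi> T = S \<circ> T\<close>. For \<open>S\<close> on \<open>X*\<close>, the adjoint of \<open>\<Phi> T\<close> should be \<open>S \<circ> T*\<close>, that is,
  \<open>g \<circ> \<Phi> T = S (g \<circ> T)\<close> for all \<open>g\<close> in \<open>Y*\<close>. Such an operator need not exist for a general bounded
  \<open>T\<close>, since \<open>S \<circ> T*\<close> need not be an adjoint. On rank-one operators \<open>f \<otimes> y\<close> it is \<open>S f \<otimes> y\<close>, this
  extends to finite sums, and since the condition forces \<open>\<parallel>\<Phi> T\<parallel> \<le> \<parallel>S\<parallel> \<parallel>T\<parallel>\<close> it extends to norm limits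
  by completeness of \<open>Y\<close> (\<open>dual_lift_exists\<close>). In both cases \<open>a I + c \<Phi>\<close> arises from \<open>a I + c S\<close> by
  the same construction, so its norm is no larger, and rank-one operators show that the norm of
  \<open>\<Phi>\<close> is not smaller than that of \<open>S\<close>.

  States, the norm estimates and the splitting of finite-rank operators into rank-one operators
  all rest on the Hahn-Banach theorem over the scalar field, in the form \<open>norming_functional\<close>.
\<close>

section \<open>Norming functionals on real normed spaces\<close>

definition sublinear :: "('a::real_vector \<Rightarrow> real) \<Rightarrow> bool" where
  "sublinear q \<longleftrightarrow>
     (\<forall>x y. q (x + y) \<le> q x + q y) \<and> (\<forall>r x. r \<ge> 0 \<longrightarrow> q (r *\<^sub>R x) = r * q x)"

lemma sublinear_norm: "sublinear (norm :: 'a::real_normed_vector \<Rightarrow> real)"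
  by (simp add: sublinear_def norm_triangle_ineq)

lemma sublinear_add: "sublinear q \<Longrightarrow> q (x + y) \<le> q x + q y"
  by (simp add: sublinear_def)

lemma sublinear_scaleR: "sublinear q \<Longrightarrow> r \<ge> 0 \<Longrightarrow> q (r *\<^sub>R x) = r * q x"
  by (simp add: sublinear_def)

lemma sublinear_zero: "sublinear q \<Longrightarrow> q 0 = 0"
  using sublinear_scaleR[of q 0 0] by simp

lemma sublinear_neg_le: "sublinear q \<Longrightarrow> - q (- x) \<le> q x"
  using sublinear_add[of q x "- x"] by (simp add: sublinear_zero)

text \<open>
  The new functional is \<open>q' z = inf {q (z + t y) - t q y | t \<ge> 0}\<close>; the parameters \<open>t = 0\<close> and \<open>t = 1\<close>
  give the two bounds. A minimal \<open>q\<close> must agree with \<open>q'\<close> for each \<open>y\<close>, which makes it additive; for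
  \<open>q = norm\<close> and \<open>z = - y\<close> the second bound pins down the value at \<open>y\<close>.
\<close>

lemma sublinear_additive_at:
  fixes q :: "'a::real_vector \<Rightarrow> real"
  assumes q: "sublinear q"
  obtains q' where "sublinear q'" "\<And>z. q' z \<le> q z" "\<And>z. q' z \<le> q (z + y) - q y"
proof -
  define h where "h z t = q (z + t *\<^sub>R y) - t * q y" for z t
  define q' where "q' z = (INF t\<in>{0..}. h z t)" for z
  have h_ge: "- q (- z) \<le> h z t" if "t \<ge> 0" for z t
    using sublinear_add[OF q, of "z + t *\<^sub>R y" "- z"] sublinear_scaleR[OF q that]
    by (simp add: h_def)
  have bdd: "bdd_below (h z ` {0..})" for z
    by (rule bdd_belowI2[where m = "- q (- z)"]) (use h_ge in auto)
  have low: "q' z \<le> h z t" if "t \<ge> 0" for z t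
    unfolding q'_def using bdd that by (intro cINF_lower) auto
  have great: "m \<le> q' z" if "\<And>t. t \<ge> 0 \<Longrightarrow> m \<le> h z t" for m z
    unfolding q'_def using that by (intro cINF_greatest) auto
  have add: "q' (z + w) \<le> q' z + q' w" for z w
  proof -
    have "q' (z + w) - h w t \<le> h z s" if "s \<ge> 0" "t \<ge> 0" for s t
      using low[of "s + t" "z + w"] that
        sublinear_add[OF q, of "z + s *\<^sub>R y" "w + t *\<^sub>R y"]
      by (simp add: h_def algebra_simps)
    then have "q' (z + w) - h w t \<le> q' z" if "t \<ge> 0" for t
      using that by (intro great) auto
    then have "q' (z + w) - q' z \<le> q' w"
      by (intro great) (simp add: algebra_simps)
    then show ?thesis by simp
  qed
  have zero: "q' 0 = 0"
    using low[of 0 0] great[of 0 0] h_ge[of _ 0]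
    by (simp add: h_def sublinear_zero[OF q])
  have le: "q' (r *\<^sub>R z) \<le> r * q' z" if "r > 0" for r z
  proof -
    have "q' (r *\<^sub>R z) / r \<le> h z t" if "t \<ge> 0" for t
    proof -
      have "q' (r *\<^sub>R z) \<le> h (r *\<^sub>R z) (r * t)"
        using \<open>r > 0\<close> that by (intro low) auto
      also have "\<dots> = r * h z t"
        using sublinear_scaleR[OF q, of r "z + t *\<^sub>R y"] \<open>r > 0\<close>
        by (simp add: h_def algebra_simps)
      finally show ?thesis using \<open>r > 0\<close> by (simp add: field_simps)
    qed
    then have "q' (r *\<^sub>R z) / r \<le> q' z" by (rule great)
    then show ?thesis using that by (simp add: field_simps)
  qed
  have "q' (r *\<^sub>R z) = r * q' z" if "r \<ge> 0" for r z
  proof (cases "r = 0")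
    case False
    then have "r > 0" using that by simp
    then show ?thesis
      using le[of r z] le[of "inverse r" "r *\<^sub>R z"] by (simp add: field_simps)
  qed (simp add: zero)
  with add have "sublinear q'" by (simp add: sublinear_def)
  moreover have "q' z \<le> q z" for z using low[of 0 z] by (simp add: h_def)
  moreover have "q' z \<le> q (z + y) - q y" for z using low[of 1 z] by (simp add: h_def)
  ultimately show thesis by (rule that)
qed

lemma sublinear_INF_chain:
  fixes C :: "('a::real_vector \<Rightarrow> real) set"
  assumes ne: "C \<noteq> {}" and sub: "\<And>q. q \<in> C \<Longrightarrow> sublinear q"
    and le: "\<And>q x. q \<in> C \<Longrightarrow> q x \<le> p x"
    and chain: "\<And>q r. q \<in> C \<Longrightarrow> r \<in> C \<Longrightarrow> q \<le> r \<or> r \<le> q"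
  shows "sublinear (\<lambda>x. INF q\<in>C. q x)" and "\<And>q x. q \<in> C \<Longrightarrow> (INF q\<in>C. q x) \<le> q x"
proof -
  have bdd: "bdd_below ((\<lambda>q. q x) ` C)" for x
  proof (rule bdd_belowI2[where m = "- p (- x)"])
    fix q assume "q \<in> C"
    then show "- p (- x) \<le> q x"
      using sublinear_neg_le[OF sub, of q x] le[of q "- x"] by linarith
  qed
  show low: "(INF q\<in>C. q x) \<le> q x" if "q \<in> C" for q x
    using that bdd by (intro cINF_lower) auto
  show "sublinear (\<lambda>x. INF q\<in>C. q x)"
    unfolding sublinear_def
  proof safe
    fix x y
    have sum: "(INF q\<in>C. q (x + y)) \<le> q x + r y" if qr: "q \<in> C" "r \<in> C" for q r
    proof -
      \<comment> \<open>The smaller of the two members of the chain bounds both summands.\<close>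
      obtain m where m: "m \<in> C" "m \<le> q" "m \<le> r" using chain[OF qr] qr by blast
      have "(INF q\<in>C. q (x + y)) \<le> m x + m y"
        using low[OF m(1), of "x + y"] sublinear_add[OF sub[OF m(1)], of x y] by linarith
      also have "\<dots> \<le> q x + r y" using m(2,3) by (intro add_mono) (auto simp: le_fun_def)
      finally show ?thesis .
    qed
    have "(INF q\<in>C. q (x + y)) - r y \<le> (INF q\<in>C. q x)" if "r \<in> C" for r
      using ne sum[OF _ that] by (intro cINF_greatest) (auto simp: algebra_simps)
    then have "(INF q\<in>C. q (x + y)) - (INF q\<in>C. q x) \<le> (INF q\<in>C. q y)"
      using ne by (intro cINF_greatest) (auto simp: algebra_simps)
    then show "(INF q\<in>C. q (x + y)) \<le> (INF q\<in>C. q x) + (INF q\<in>C. q y)" by simp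
  next
    fix r :: real and x assume "0 \<le> r"
    have le: "(INF q\<in>C. q (s *\<^sub>R x)) \<le> s * (INF q\<in>C. q x)" if "s > 0" for s x
    proof -
      have "(INF q\<in>C. q (s *\<^sub>R x)) / s \<le> (INF q\<in>C. q x)"
        using ne
      proof (rule cINF_greatest)
        fix q assume "q \<in> C"
        then show "(INF q\<in>C. q (s *\<^sub>R x)) / s \<le> q x"
          using low[of q "s *\<^sub>R x"] sublinear_scaleR[OF sub, of q s x] that
          by (simp add: field_simps)
      qed
      then show ?thesis using that by (simp add: field_simps)
    qed
    show "(INF q\<in>C. q (r *\<^sub>R x)) = r * (INF q\<in>C. q x)"
    proof (cases "r = 0")
      case True
      have "(INF q\<in>C. q 0) = (INF q\<in>C. (0::real))"
        using sub by (intro INF_cong) (auto simp: sublinear_zero)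
      then show ?thesis using True ne by simp
    next
      case False
      then have "r > 0" using \<open>0 \<le> r\<close> by simp
      then show ?thesis
        using le[of r x] le[of "inverse r" "r *\<^sub>R x"] by (simp add: field_simps)
    qed
  qed
qed

text \<open>
  Zorn's lemma yields a minimal sublinear functional below \<open>p\<close>. By minimality it cannot be lowered
  by \<open>sublinear_additive_at\<close> in any direction, so it is superadditive, hence linear.
\<close>

lemma sublinear_dominates_linear:
  fixes p :: "'a::real_vector \<Rightarrow> real"
  assumes p: "sublinear p"
  obtains g where "linear g" "\<And>x. g x \<le> p x"
proof -
  define A where "A = {q. sublinear q \<and> q \<le> p}"
  have "\<exists>m\<in>A. \<forall>a\<in>A. a \<le> m \<longrightarrow> a = m"
  proof (rule predicate_Zorn[where P = "\<lambda>f g. g \<le> f"])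
    show "partial_order_on A (relation_of (\<lambda>f g. g \<le> f) A)"
      by (auto simp: partial_order_on_def preorder_on_def refl_on_def trans_def antisym_def
          relation_of_def)
    fix C assume "C \<in> Chains (relation_of (\<lambda>f g. g \<le> f) A)"
    then have C: "C \<subseteq> A" "\<And>q r. q \<in> C \<Longrightarrow> r \<in> C \<Longrightarrow> q \<le> r \<or> r \<le> q"
      by (auto simp: Chains_def relation_of_def)
    show "\<exists>u\<in>A. \<forall>a\<in>C. u \<le> a"
    proof (cases "C = {}")
      case True
      then show ?thesis using p by (auto simp: A_def)
    next
      case False
      let ?u = "\<lambda>x. INF q\<in>C. q x"
      have *: "sublinear q" "q x \<le> p x" if "q \<in> C" for q x
        using that C(1) by (auto simp: A_def le_fun_def)
      have u: "sublinear ?u" "\<And>q x. q \<in> C \<Longrightarrow> ?u x \<le> q x"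
        by (rule sublinear_INF_chain[where p = p and C = C]; use False * C(2) in blast)+
      obtain q where "q \<in> C" using False by blast
      then have "?u \<le> p"
        using u(2) *(2) by (meson le_funI order_trans)
      then have "?u \<in> A" using u(1) by (simp add: A_def)
      moreover have "\<forall>a\<in>C. ?u \<le> a" using u(2) by (simp add: le_fun_def)
      ultimately show ?thesis by blast
    qed
  qed
  then obtain g where g: "sublinear g" "g \<le> p" and min: "\<And>q. q \<in> A \<Longrightarrow> q \<le> g \<Longrightarrow> q = g"
    by (auto simp: A_def)
  have add: "g (z + y) = g z + g y" for z y
  proof -
    obtain q where q: "sublinear q" "\<And>z. q z \<le> g z" "\<And>z. q z \<le> g (z + y) - g y"
      using sublinear_additive_at[OF g(1)] by blast
    have "q \<le> g" using q(2) by (simp add: le_fun_def)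
    then have "q = g" using q(1) g(2) by (intro min) (auto simp: A_def)
    then have "g z \<le> g (z + y) - g y" using q(3) by blast
    then show ?thesis using sublinear_add[OF g(1), of z y] by linarith
  qed
  have neg: "g (- z) = - g z" for z
    using add[of z "- z"] sublinear_zero[OF g(1)] by simp
  have "g (r *\<^sub>R z) = r * g z" for r z
  proof (cases "r \<ge> 0")
    case False
    then have "g ((- r) *\<^sub>R z) = (- r) * g z" by (intro sublinear_scaleR[OF g(1)]) auto
    then show ?thesis using neg[of "r *\<^sub>R z"] by simp
  qed (rule sublinear_scaleR[OF g(1)])
  then have "linear g" by (intro linearI) (auto simp: add)
  moreover have "g x \<le> p x" for x using g(2) by (simp add: le_fun_def)
  ultimately show thesis by (rule that)
qed

text \<open>
  The norm is first lowered to a sublinear functional with value at most \<open>- norm x\<close> at \<open>- x\<close>; every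
  linear functional below it has value at least, hence exactly, \<open>norm x\<close> at \<open>x\<close>.
\<close>

lemma real_norming_functional:
  fixes x :: "'a::real_normed_vector"
  obtains g :: "'a \<Rightarrow> real" where "linear g" "\<And>y. g y \<le> norm y" "g x = norm x"
proof -
  obtain p where p: "sublinear p" "\<And>z. p z \<le> norm z" "\<And>z. p z \<le> norm (z + x) - norm x"
    using sublinear_additive_at[OF sublinear_norm] by blast
  obtain g where g: "linear g" "\<And>z. g z \<le> p z"
    using sublinear_dominates_linear[OF p(1)] by blast
  have "- g x \<le> - norm x"
    using g(2)[of "- x"] p(3)[of "- x"] linear_neg[OF g(1)] by simp
  moreover have le: "g y \<le> norm y" for y
    using g(2) p(2) order_trans by blast
  ultimately have "g x = norm x" using le[of x] by simp
  with g(1) le show thesis by (rule that)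
qed

section \<open>Norming functionals over the scalar field\<close>

lemma normed_space_over_times:
  "normed_space_over ((*) :: 'k::real_or_complex \<Rightarrow> 'k \<Rightarrow> 'k)"
  by unfold_locales (auto simp: algebra_simps norm_mult scaleR_conv_of_real)

text \<open>
  Real coordinates and, in the second case, an imaginary unit suffice to pass from real-linear to
  scalar-linear functionals; both are read off from the embedding into the complex numbers.
\<close>

lemma real_or_complex_cases:
  obtains (real) "\<And>a :: 'k::real_or_complex. \<exists>r. a = of_real r"
  | (complex) i :: "'k::real_or_complex" where "i * i = - 1"
      "\<And>a. \<exists>r s. a = of_real r + of_real s * i"
      "\<And>r s. (norm (of_real r + of_real s * i))\<^sup>2 = r\<^sup>2 + s\<^sup>2"
proof -
  obtain \<phi> :: "'k \<Rightarrow> complex" where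
    add: "\<And>a b. \<phi> (a + b) = \<phi> a + \<phi> b" and mult: "\<And>a b. \<phi> (a * b) = \<phi> a * \<phi> b" and
    scaleR: "\<And>r a. \<phi> (r *\<^sub>R a) = r *\<^sub>R \<phi> a" and norm: "\<And>a. norm (\<phi> a) = norm a" and
    range: "range \<phi> = \<real> \<or> range \<phi> = UNIV"
    using real_or_complex_embedding by metis
  have minus: "\<phi> (a - b) = \<phi> a - \<phi> b" for a b
    using add[of "a - b" b] by simp
  have inj: "a = b" if "\<phi> a = \<phi> b" for a b
    using norm[of "a - b"] minus[of a b] that by simp
  have one: "\<phi> 1 = 1"
    using mult[of 1 1] norm[of 1] by (metis mult_cancel_left mult.right_neutral norm_one norm_zero zero_neq_one)
  have of_real: "\<phi> (of_real r) = of_real r" for r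
    using scaleR[of r 1] by (simp add: one of_real_def)
  from range show thesis
  proof
    assume R: "range \<phi> = \<real>"
    have "\<exists>r. a = of_real r" for a :: 'k
    proof -
      have "\<phi> a \<in> \<real>" using R by blast
      then obtain r where "\<phi> a = of_real r" by (auto elim: Reals_cases)
      then have "a = of_real r" by (intro inj) (simp add: of_real)
      then show ?thesis ..
    qed
    then show thesis by (rule real)
  next
    assume U: "range \<phi> = UNIV"
    then obtain i where i: "\<phi> i = \<i>" by (metis surjD)
    have \<phi>: "\<phi> (of_real r + of_real s * i) = Complex r s" for r s
      by (simp add: add mult of_real i complex_eq_iff)
    show thesis
    proof (rule complex[of i])
      have "\<phi> (i * i) = \<phi> (- 1)"
        using minus[of 0 1] minus[of 0 0] by (simp add: mult i one)
      then show "i * i = - 1" by (rule inj)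
      show "\<exists>r s. a = of_real r + of_real s * i" for a
      proof (intro exI)
        show "a = of_real (Re (\<phi> a)) + of_real (Im (\<phi> a)) * i"
          by (rule inj) (simp add: \<phi>)
      qed
      show "(norm (of_real r + of_real s * i))\<^sup>2 = r\<^sup>2 + s\<^sup>2" for r s
        using norm[of "of_real r + of_real s * i"] by (metis \<phi> cmod_power2 complex.sel)
    qed
  qed
qed

lemma obtain_phase:
  fixes a :: "'k::real_or_complex"
  obtains c where "norm c = 1" "c * a = of_real (norm a)"
proof (cases "a = 0")
  case True
  then show ?thesis using that[of 1] by simp
next
  case False
  then show ?thesis using that[of "of_real (norm a) / a"] by (simp add: norm_divide)
qed

lemma mem_linear_ops:
  assumes "normed_space_over s" "normed_space_over t"
  shows "T \<in> linear_ops s t \<longleftrightarrow> (\<forall>c x. blinfun_apply T (s c x) = t c (blinfun_apply T x))"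
  using assms
  by (auto simp: linear_ops_def normed_space_over_def Vector_Spaces.linear_iff blinfun.add_right)

lemma linear_op_exists:
  assumes s: "normed_space_over s" and t: "normed_space_over t"
    and add: "\<And>x y. T (x + y) = T x + T y" and scale: "\<And>c x. T (s c x) = t c (T x)"
    and bound: "\<And>x. norm (T x) \<le> K * norm x"
  obtains U where "U \<in> linear_ops s t" "blinfun_apply U = T"
proof -
  have "T (r *\<^sub>R x) = r *\<^sub>R T x" for r x
    using scale[of "of_real r" x]
    by (simp add: normed_space_over.scale_of_real[OF s] normed_space_over.scale_of_real[OF t])
  then have "bounded_linear T"
    using add bound by (intro bounded_linear_intro[where K = K]) (auto simp: mult.commute)
  then have *: "blinfun_apply (Blinfun T) = T" by (rule bounded_linear_Blinfun_apply)
  then have "Blinfun T \<in> linear_ops s t" by (simp add: mem_linear_ops[OF s t] scale)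
  with * show thesis by (rule that[rotated])
qed

context normed_space_over
begin

text \<open>
  Over the complex numbers, a real-linear \<open>g\<close> is the real part of the complex-linear
  \<open>f y = g y - i g (i y)\<close>. If \<open>c\<close> is a phase with \<open>c f y = |f y|\<close>, then \<open>|f y| = f (c y) = g (c y)\<close>,
  so the bound on \<open>g\<close> carries over to \<open>f\<close>.
\<close>

lemma norming_functional:
  fixes x :: 'a
  obtains f where "f \<in> dual_space scale" "norm f \<le> 1" "blinfun_apply f x = of_real (norm x)"
proof -
  have ex: "\<exists>f. (\<forall>x y. f (x + y) = f x + f y) \<and> (\<forall>c x. f (scale c x) = c * f x) \<and>
    (\<forall>y. norm (f y) \<le> norm y) \<and> f x = of_real (norm x)"
  proof -
    obtain g :: "'a \<Rightarrow> real" where g: "linear g" "\<And>y. g y \<le> norm y" "g x = norm x"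
      using real_norming_functional by blast
    have g_minus: "g (- y) = - g y" for y using g(1) by (rule linear_neg)
    have g_scale: "g (scale (of_real r) y) = r * g y" for r y
      by (simp add: scale_of_real linear_cmul[OF g(1)])
    show ?thesis
    proof (cases rule: real_or_complex_cases[where 'k = 'k])
      case real
      have "\<bar>g y\<bar> \<le> norm y" for y using g(2)[of y] g(2)[of "- y"] g_minus[of y] by simp
      moreover have "of_real (g (scale c y)) = c * of_real (g y)" for c y
        using real[of c] g_scale by auto
      ultimately show ?thesis
        by (intro exI[of _ "\<lambda>y. of_real (g y)"]) (auto simp: linear_add[OF g(1)] g(3))
    next
      case (complex i)
      define f :: "'a \<Rightarrow> 'k" where "f y = of_real (g y) - of_real (g (scale i y)) * i" for y
      have add: "f (y + z) = f y + f z" for y z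
        by (simp add: f_def scale_right_distrib linear_add[OF g(1)] algebra_simps)
      have scale_i: "scale i (scale i y) = - y" for y
        by (simp add: complex(1))
      have ii: "i * (i * a) = - a" for a
        by (simp add: complex(1) flip: mult.assoc)
      have fr: "f (scale (of_real r) y) = of_real r * f y" for r y
        unfolding f_def scale_left_commute[of i "of_real r" y] g_scale
        by (simp add: algebra_simps)
      have fi: "f (scale i y) = i * f y" for y
        unfolding f_def scale_i g_minus by (simp add: algebra_simps ii)
      have scale: "f (scale c y) = c * f y" for c y
      proof -
        obtain r s where c: "c = of_real r + of_real s * i" using complex(2) by blast
        have "scale c y = scale (of_real r) y + scale (of_real s) (scale i y)"
          by (simp add: c scale_left_distrib)
        then have "f (scale c y) = of_real r * f y + of_real s * (i * f y)"
          by (simp only: add fr fi)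
        then show ?thesis by (simp add: c algebra_simps)
      qed
      have bound: "norm (f y) \<le> norm y" for y
      proof -
        obtain c where c: "norm c = 1" "c * f y = of_real (norm (f y))"
          using obtain_phase by blast
        define r where "r = norm (f y) - g (scale c y)"
        define s where "s = g (scale i (scale c y))"
        have "f (scale c y) = of_real (norm (f y))" by (simp add: scale c)
        then have "of_real r + of_real s * i = 0"
          unfolding f_def r_def s_def by (simp add: algebra_simps)
        then have "r\<^sup>2 + s\<^sup>2 = 0" using complex(3)[of r s] by simp
        then have "norm (f y) = g (scale c y)" by (simp add: r_def)
        also have "\<dots> \<le> norm y" using g(2)[of "scale c y"] by (simp add: norm_scale c)
        finally show ?thesis .
      qed
      \<comment> \<open>The real part of \<open>f x\<close> already has modulus \<open>norm x\<close>, so the imaginary part vanishes.\<close>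
      have "(norm (f x))\<^sup>2 = (norm x)\<^sup>2 + (g (scale i x))\<^sup>2"
        using complex(3)[of "norm x" "- g (scale i x)"] by (simp add: f_def g(3))
      moreover have "(norm (f x))\<^sup>2 \<le> (norm x)\<^sup>2"
        using bound[of x] by (simp add: power_mono)
      ultimately have "g (scale i x) = 0" by simp
      then have "f x = of_real (norm x)" by (simp add: f_def g(3))
      with add scale bound show ?thesis by blast
    qed
  qed
  then obtain f where f: "\<And>x y. f (x + y) = f x + f y" "\<And>c x. f (scale c x) = c * f x"
    "\<And>y. norm (f y) \<le> 1 * norm y" "f x = of_real (norm x)" by auto
  obtain U where U: "U \<in> linear_ops scale (*)" "blinfun_apply U = f"
    using linear_op_exists[OF normed_space_over_axioms normed_space_over_times f(1-3)] by blast
  have "norm U \<le> 1" using f(3) U(2) by (intro norm_blinfun_bound) auto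
  with U f(4) show thesis by (intro that[of U]) (auto simp: dual_space_def)
qed

end

section \<open>Numerical radius and norms of perturbed identities\<close>

lemma bounded_linear_on_bound:
  assumes "bounded_linear_on s V t W T"
  obtains B where "B \<ge> 0" "\<And>x. x \<in> V \<Longrightarrow> norm (T x) \<le> B * norm x"
proof -
  obtain B where B: "\<And>x. x \<in> V \<Longrightarrow> norm (T x) \<le> B * norm x"
    using assms unfolding bounded_linear_on_def by blast
  have "norm (T x) \<le> \<bar>B\<bar> * norm x" if "x \<in> V" for x
    using B[OF that] mult_right_mono[OF abs_ge_self norm_ge_zero, of B x] by linarith
  then show thesis using that[of "\<bar>B\<bar>"] by simp
qed

lemma norm_le_onorm_on:
  assumes T: "bounded_linear_on s V t W T" and x: "x \<in> V"
  shows "norm (T x) \<le> onorm_on V T * norm x"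
proof -
  obtain B where B: "B \<ge> 0" "\<And>x. x \<in> V \<Longrightarrow> norm (T x) \<le> B * norm x"
    using bounded_linear_on_bound[OF T] by blast
  show ?thesis
  proof (cases "x = 0")
    case True
    then show ?thesis using B(2)[OF x] by simp
  next
    case False
    have "norm (T x) / norm x \<le> onorm_on V T"
      unfolding onorm_on_def
    proof (rule cSUP_upper[OF x])
      have "norm (T y) / norm y \<le> B" if "y \<in> V" for y
        using B(2)[OF that] B(1) by (cases "y = 0") (auto simp: field_simps)
      then show "bdd_above ((\<lambda>x. norm (T x) / norm x) ` V)" by (rule bdd_aboveI2)
    qed
    then show ?thesis using False by (simp add: field_simps)
  qed
qed

lemma onorm_on_le:
  assumes "V \<noteq> {}" "K \<ge> 0" "\<And>x. x \<in> V \<Longrightarrow> norm (T x) \<le> K * norm x"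
  shows "onorm_on V T \<le> K"
  unfolding onorm_on_def
proof (rule cSUP_least)
  show "norm (T x) / norm x \<le> K" if "x \<in> V" for x
    using assms(2) assms(3)[OF that] by (cases "x = 0") (auto simp: field_simps)
qed (rule assms)

locale normed_subspace = normed_space_over scale
  for scale :: "'k::real_or_complex \<Rightarrow> 'a::real_normed_vector \<Rightarrow> 'a" +
  fixes V :: "'a set"
  assumes subspace: "subspace V" and nontrivial: "\<exists>x\<in>V. x \<noteq> 0"
begin

lemma closed_add: "x \<in> V \<Longrightarrow> y \<in> V \<Longrightarrow> x + y \<in> V"
  and closed_diff: "x \<in> V \<Longrightarrow> y \<in> V \<Longrightarrow> x - y \<in> V"
  and closed_scale: "x \<in> V \<Longrightarrow> scale c x \<in> V"
  and nonempty: "V \<noteq> {}"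
  using subspace nontrivial by (auto simp: subspace_add subspace_diff subspace_scale)

lemma unit_vector_exists: "\<exists>x\<in>V. norm x = 1"
proof -
  obtain x where x: "x \<in> V" "x \<noteq> 0" using nontrivial by blast
  have "scale (of_real (inverse (norm x))) x \<in> V" using x(1) by (rule closed_scale)
  then show ?thesis
    using x(2) by (intro bexI[of _ "scale (of_real (inverse (norm x))) x"]) (auto simp: norm_scale norm_inverse)
qed

abbreviation operator :: "('a \<Rightarrow> 'a) \<Rightarrow> bool" where
  "operator T \<equiv> bounded_linear_on scale V scale V T"

definition state_at :: "'a \<Rightarrow> ('a \<Rightarrow> 'k) \<Rightarrow> bool" where
  "state_at x f \<longleftrightarrow> x \<in> V \<and> norm x = 1 \<and>
     bounded_linear_on scale V (*) (UNIV :: 'k set) f \<and> onorm_on V f = 1 \<and> f x = 1"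

lemma numerical_radius_eq:
  "numerical_radius scale V T = Sup {norm (f (T x)) | x f. state_at x f}"
  by (simp add: numerical_radius_def state_at_def)

lemma state_exists:
  assumes x: "x \<in> V" "norm x = 1"
  obtains f where "state_at x f"
proof -
  obtain f where f: "f \<in> dual_space scale" "norm f \<le> 1" "blinfun_apply f x = of_real (norm x)"
    using norming_functional by blast
  have le: "norm (blinfun_apply f y) \<le> 1 * norm y" for y
    using norm_blinfun[of f y] f(2) mult_right_mono[of "norm f" 1 "norm y"] by simp
  have lin: "bounded_linear_on scale V (*) (UNIV :: 'k set) (blinfun_apply f)"
    using f(1) le
    by (auto simp: bounded_linear_on_def dual_space_def blinfun.add_right
        mem_linear_ops[OF normed_space_over_axioms normed_space_over_times]
        intro!: exI[of _ 1])
  have "onorm_on V (blinfun_apply f) \<le> 1"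
    using le nonempty by (intro onorm_on_le) auto
  moreover have "1 \<le> onorm_on V (blinfun_apply f)"
    using norm_le_onorm_on[OF lin x(1)] f(3) x(2) by simp
  ultimately have "state_at x (blinfun_apply f)"
    using x lin f(3) by (simp add: state_at_def)
  then show thesis by (rule that)
qed

lemma state_at_norm_le: "state_at x f \<Longrightarrow> y \<in> V \<Longrightarrow> norm (f y) \<le> norm y"
  using norm_le_onorm_on[of scale V "(*)" UNIV f y] by (simp add: state_at_def)

lemma norm_le_numerical_radius:
  assumes T: "operator T" and xf: "state_at x f"
  shows "norm (f (T x)) \<le> numerical_radius scale V T"
  unfolding numerical_radius_eq
proof (rule cSup_upper)
  obtain B where B: "B \<ge> 0" "\<And>x. x \<in> V \<Longrightarrow> norm (T x) \<le> B * norm x"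
    using bounded_linear_on_bound[OF T] by blast
  show "bdd_above {norm (f (T x)) | x f. state_at x f}"
  proof (rule bdd_aboveI)
    fix r assume "r \<in> {norm (f (T x)) | x f. state_at x f}"
    then obtain x f where xf: "state_at x f" and r: "r = norm (f (T x))" by blast
    have x: "x \<in> V" "norm x = 1" using xf by (auto simp: state_at_def)
    then have "T x \<in> V" using T by (auto simp: bounded_linear_on_def)
    then have "r \<le> norm (T x)" unfolding r by (rule state_at_norm_le[OF xf])
    also have "\<dots> \<le> B" using B(2)[OF x(1)] x(2) by simp
    finally show "r \<le> B" .
  qed
qed (use xf in blast)

lemma numerical_radius_nonneg: "operator T \<Longrightarrow> 0 \<le> numerical_radius scale V T"
  using unit_vector_exists state_exists norm_le_numerical_radius norm_ge_zero order_trans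
  by metis

text \<open>
  A state \<open>f\<close> at the normalisation of \<open>y\<close> satisfies \<open>f y = \<parallel>y\<parallel>\<close>, while it sends
  \<open>c T y\<close> to a scalar of modulus at most \<open>|c| v(T) \<parallel>y\<parallel>\<close>.
\<close>

lemma norm_diff_ge_numerical_radius:
  assumes T: "operator T" and y: "y \<in> V"
  shows "(1 - norm c * numerical_radius scale V T) * norm y \<le> norm (y - scale c (T y))"
proof (cases "y = 0")
  case False
  define r :: 'k where "r = of_real (norm y)"
  define x where "x = scale (inverse r) y"
  have r: "r \<noteq> 0" "norm r = norm y" using False by (auto simp: r_def)
  have x: "x \<in> V" "norm x = 1" using y r False by (auto simp: x_def closed_scale norm_scale norm_inverse)
  have yx: "y = scale r x" using r by (simp add: x_def)
  obtain f where f: "state_at x f" using state_exists[OF x] by blast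
  have Tx: "T x \<in> V" and Ty: "T y = scale r (T x)"
    using T x(1) unfolding yx by (auto simp: bounded_linear_on_def)
  have f_scale: "f (scale a z) = a * f z" if "z \<in> V" for a z
    using f that by (auto simp: state_at_def bounded_linear_on_def)
  have f_add: "f (z + w) = f z + f w" if "z \<in> V" "w \<in> V" for z w
    using f that by (auto simp: state_at_def bounded_linear_on_def)
  have "f (y - scale c (T y)) = f (scale r (x + scale (- c) (T x)))"
    by (simp add: yx Ty[unfolded yx] scale_right_diff_distrib mult.commute)
  also have "\<dots> = r * (f x + (- c) * f (T x))"
    using x(1) Tx by (simp only: f_scale f_add closed_add closed_scale)
  also have "f x = 1" using f by (simp add: state_at_def)
  finally have eq: "norm (f (y - scale c (T y))) = norm y * norm (1 - c * f (T x))"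
    by (simp add: norm_mult r)
  have "1 - norm c * numerical_radius scale V T \<le> 1 - norm (c * f (T x))"
    using mult_left_mono[OF norm_le_numerical_radius[OF T f], of "norm c"] by (simp add: norm_mult)
  also have "\<dots> \<le> norm (1 - c * f (T x))"
    using norm_triangle_ineq2[of 1 "c * f (T x)"] by simp
  finally have "(1 - norm c * numerical_radius scale V T) * norm y
      \<le> norm (f (y - scale c (T y)))"
    unfolding eq by (subst mult.commute) (simp add: mult_left_mono)
  also have "\<dots> \<le> norm (y - scale c (T y))"
    using y Tx Ty by (intro state_at_norm_le[OF f] closed_diff closed_scale) (auto simp: closed_scale)
  finally show ?thesis .
qed simp

text \<open>
  The lower bound of \<open>norm_diff_ge_numerical_radius\<close> is applied to \<open>y = (I + c T) x\<close>, for which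
  \<open>(I - c T) y = x - c\<^sup>2 T\<^sup>2 x\<close> differs from \<open>x\<close> only to second order in \<open>c\<close>.
\<close>

lemma norm_add_le_numerical_radius:
  assumes T: "operator T" and B: "\<And>x. x \<in> V \<Longrightarrow> norm (T x) \<le> B * norm x" and "B \<ge> 0"
    and small: "norm c * numerical_radius scale V T < 1" and x: "x \<in> V"
  shows "norm (x + scale c (T x))
    \<le> (1 + (norm c * B)\<^sup>2) / (1 - norm c * numerical_radius scale V T) * norm x"
proof -
  let ?v = "numerical_radius scale V T"
  have T_mem: "T z \<in> V" if "z \<in> V" for z using T that by (auto simp: bounded_linear_on_def)
  define y where "y = x + scale c (T x)"
  have y: "y \<in> V" unfolding y_def using x by (intro closed_add closed_scale T_mem)
  have "T y = T x + scale c (T (T x))"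
    unfolding y_def using T x closed_scale[OF T_mem[OF x], of c] T_mem[OF x]
    by (simp add: bounded_linear_on_def)
  then have "y - scale c (T y) = x - scale (c * c) (T (T x))"
    by (simp add: y_def scale_right_distrib)
  also have "norm \<dots> \<le> norm x + norm c * norm c * norm (T (T x))"
    using norm_triangle_ineq4[of x "scale (c * c) (T (T x))"] by (simp add: norm_scale norm_mult)
  also have "norm (T (T x)) \<le> B * (B * norm x)"
    using B[OF T_mem[OF x]] mult_left_mono[OF B[OF x] \<open>B \<ge> 0\<close>] by linarith
  also have "norm x + norm c * norm c * (B * (B * norm x)) = (1 + (norm c * B)\<^sup>2) * norm x"
    by (simp add: power2_eq_square algebra_simps)
  finally have "norm (y - scale c (T y)) \<le> (1 + (norm c * B)\<^sup>2) * norm x"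
    by (simp add: mult_left_mono)
  then have "(1 - norm c * ?v) * norm y \<le> (1 + (norm c * B)\<^sup>2) * norm x"
    using norm_diff_ge_numerical_radius[OF T y, of c] by linarith
  then show ?thesis using small unfolding y_def by (simp add: field_simps)
qed

end

text \<open>
  The last hypothesis says that \<open>\<parallel>I + c \<Phi>\<parallel> \<le> \<parallel>I + c T\<parallel>\<close> for all scalars \<open>c\<close>. The numerical radius is the
  supremum over all phases \<open>u\<close> of the right derivative of \<open>\<alpha> \<mapsto> \<parallel>I + \<alpha> u T\<parallel>\<close> at \<open>0\<close>, hence monotone in these
  norms. The proof compares difference quotients at one small \<open>\<alpha>\<close>.
\<close>

lemma numerical_radius_le_transfer:
  fixes s :: "'k::real_or_complex \<Rightarrow> 'a::real_normed_vector \<Rightarrow> 'a"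
    and t :: "'k \<Rightarrow> 'b::real_normed_vector \<Rightarrow> 'b"
  assumes V: "normed_subspace s V" and W: "normed_subspace t W"
    and T: "bounded_linear_on s V s V T" and \<Phi>: "bounded_linear_on t W t W \<Phi>"
    and transfer: "\<And>c K z. (\<And>x. x \<in> V \<Longrightarrow> norm (x + s c (T x)) \<le> K * norm x) \<Longrightarrow> z \<in> W \<Longrightarrow>
          norm (z + t c (\<Phi> z)) \<le> K * norm z"
  shows "numerical_radius t W \<Phi> \<le> numerical_radius s V T"
proof -
  interpret V: normed_subspace s V by fact
  interpret W: normed_subspace t W by fact
  define v where "v = numerical_radius s V T"
  have v: "v \<ge> 0" unfolding v_def using T by (rule V.numerical_radius_nonneg)
  obtain B where B: "B \<ge> 0" "\<And>x. x \<in> V \<Longrightarrow> norm (T x) \<le> B * norm x"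
    using bounded_linear_on_bound[OF T] by blast
  have le: "norm (f (\<Phi> z)) \<le> v" if f: "W.state_at z f" for z f
  proof (rule ccontr)
    define a where "a = norm (f (\<Phi> z))"
    have z: "z \<in> W" "norm z = 1" using f by (auto simp: W.state_at_def)
    have \<Phi>z: "\<Phi> z \<in> W" using \<Phi> z by (auto simp: bounded_linear_on_def)
    obtain u where u: "norm u = 1" "u * f (\<Phi> z) = of_real a"
      unfolding a_def using obtain_phase by blast
    have small: "(1 + \<alpha> * a) * (1 - \<alpha> * v) \<le> 1 + (\<alpha> * B)\<^sup>2" if \<alpha>: "\<alpha> > 0" "\<alpha> * v < 1" for \<alpha>
    proof -
      define c where "c = of_real \<alpha> * u"
      have c: "norm c = \<alpha>" using \<alpha> u by (simp add: c_def norm_mult)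
      have "f (z + t c (\<Phi> z)) = f z + c * f (\<Phi> z)"
        using f z \<Phi>z W.closed_scale[OF \<Phi>z] by (simp add: W.state_at_def bounded_linear_on_def)
      also have "\<dots> = of_real (1 + \<alpha> * a)"
        using f u by (simp add: W.state_at_def c_def mult.assoc)
      finally have "norm (f (z + t c (\<Phi> z))) = \<bar>1 + \<alpha> * a\<bar>" by (simp only: norm_of_real)
      then have "1 + \<alpha> * a \<le> norm (z + t c (\<Phi> z))"
        using W.state_at_norm_le[OF f W.closed_add[OF z(1) W.closed_scale[OF \<Phi>z]], of c] by linarith
      also have "\<dots> \<le> (1 + (norm c * B)\<^sup>2) / (1 - norm c * v) * norm z"
        using V.norm_add_le_numerical_radius[OF T B(2) B(1), of c] \<alpha>(2) z(1)
        unfolding c v_def by (intro transfer)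
      also have "\<dots> = (1 + (\<alpha> * B)\<^sup>2) / (1 - \<alpha> * v)" by (simp add: c z)
      finally show ?thesis using \<alpha> by (simp add: field_simps)
    qed
    assume "\<not> norm (f (\<Phi> z)) \<le> v"
    then have av: "v < a" by (simp add: a_def)
    \<comment> \<open>The step \<open>\<alpha>\<close> is positive, with \<open>\<alpha> v < 1\<close> and \<open>\<alpha> (B\<^sup>2 + a v) < a - v\<close>, which contradicts \<open>small\<close>.\<close>
    define D where "D = B\<^sup>2 + a * v + 1 + v * (a - v)"
    define \<alpha> where "\<alpha> = (a - v) / D"
    have nn: "0 \<le> a * v" "0 \<le> v * (a - v)" using v av by auto
    then have D: "D > 0" unfolding D_def by (simp add: add_nonneg_pos add_pos_nonneg)
    have \<alpha>: "\<alpha> > 0" using av D by (simp add: \<alpha>_def)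
    have D\<alpha>: "\<alpha> * D = a - v" using D by (simp add: \<alpha>_def)
    have "v * (a - v) < D" using nn by (simp add: D_def add_nonneg_pos)
    then have "\<alpha> * v < 1" using D by (simp add: \<alpha>_def field_simps)
    from small[OF \<alpha> this] have "\<alpha> * (a - v) \<le> \<alpha> * (\<alpha> * (B\<^sup>2 + a * v))"
      by (simp add: power2_eq_square algebra_simps)
    then have "a - v \<le> \<alpha> * (B\<^sup>2 + a * v)" using \<alpha> by simp
    also have "\<dots> < \<alpha> * D" using \<alpha> nn by (intro mult_strict_left_mono) (auto simp: D_def)
    finally show False using D\<alpha> by simp
  qed
  obtain z f where "W.state_at z f"
    using W.unit_vector_exists W.state_exists by metis
  then have "Sup {norm (f (\<Phi> z)) | z f. W.state_at z f} \<le> v"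
    using le by (intro cSup_least) auto
  then show ?thesis by (simp add: W.numerical_radius_eq v_def)
qed

text \<open>
  The pair \<open>a = 0\<close>, \<open>c = 1\<close> of the norm condition gives \<open>\<parallel>\<Phi>\<parallel> \<le> \<parallel>T\<parallel>\<close>, the pairs with \<open>a = 1\<close> compare the
  numerical radii, and the last condition gives \<open>\<parallel>\<Phi>\<parallel> \<ge> \<parallel>T\<parallel>\<close>. So for \<open>\<parallel>T\<parallel> = 1\<close> the operator \<open>\<Phi>\<close>
  competes in the infimum that defines the numerical index of \<open>W\<close>.
\<close>

lemma numerical_index_le_transfer:
  fixes s :: "'k::real_or_complex \<Rightarrow> 'a::real_normed_vector \<Rightarrow> 'a"
    and t :: "'k \<Rightarrow> 'b::real_normed_vector \<Rightarrow> 'b"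
  assumes V: "normed_subspace s V" and W: "normed_subspace t W"
    and "\<And>T. bounded_linear_on s V s V T \<Longrightarrow> \<exists>\<Phi>. bounded_linear_on t W t W \<Phi> \<and>
      (\<forall>a c K. (\<forall>x\<in>V. norm (s a x + s c (T x)) \<le> K * norm x) \<longrightarrow>
        (\<forall>z\<in>W. norm (t a z + t c (\<Phi> z)) \<le> K * norm z)) \<and>
      (\<forall>x\<in>V. \<exists>z\<in>W. norm z = norm x \<and> norm (\<Phi> z) = norm (T x))"
  shows "numerical_index t W \<le> numerical_index s V"
proof -
  interpret V: normed_subspace s V by fact
  interpret W: normed_subspace t W by fact
  let ?R = "\<lambda>s V. {numerical_radius s V T | T. bounded_linear_on s V s V T \<and> onorm_on V T = 1}"
  have "numerical_index t W \<le> numerical_radius s V T"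
    if T: "bounded_linear_on s V s V T" "onorm_on V T = 1" for T
  proof -
    obtain \<Phi> where \<Phi>: "bounded_linear_on t W t W \<Phi>"
      and transfer: "\<And>a c K. \<forall>x\<in>V. norm (s a x + s c (T x)) \<le> K * norm x \<Longrightarrow>
        \<forall>z\<in>W. norm (t a z + t c (\<Phi> z)) \<le> K * norm z"
      and copy: "\<forall>x\<in>V. \<exists>z\<in>W. norm z = norm x \<and> norm (\<Phi> z) = norm (T x)"
      using assms(3)[OF T(1)] by blast
    have "\<forall>z\<in>W. norm (\<Phi> z) \<le> 1 * norm z"
      using transfer[of 0 1 1] norm_le_onorm_on[OF T(1)] T(2) by simp
    then have "onorm_on W \<Phi> \<le> 1"
      using W.nonempty by (intro onorm_on_le) auto
    moreover have "norm (T x) \<le> onorm_on W \<Phi> * norm x" if "x \<in> V" for x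
      using copy that norm_le_onorm_on[OF \<Phi>] by metis
    then have "1 \<le> onorm_on W \<Phi>"
      using onorm_on_le[OF V.nonempty, of "onorm_on W \<Phi>" T] T(2)
        W.unit_vector_exists norm_le_onorm_on[OF \<Phi>] norm_ge_zero
      by (metis mult.right_neutral order_trans)
    ultimately have "numerical_radius t W \<Phi> \<in> ?R t W" using \<Phi> by auto
    then have "numerical_index t W \<le> numerical_radius t W \<Phi>"
      unfolding numerical_index_def
      by (rule cInf_lower) (auto intro!: bdd_belowI[where m = 0] W.numerical_radius_nonneg)
    also have "\<dots> \<le> numerical_radius s V T"
      using transfer[of 1] by (intro numerical_radius_le_transfer[OF V W T(1) \<Phi>]) auto
    finally show ?thesis .
  qed
  moreover have "bounded_linear_on s V s V (\<lambda>x. x)"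
    by (auto simp: bounded_linear_on_def intro!: exI[of _ 1])
  moreover have "onorm_on V (\<lambda>x. x) = 1"
  proof (rule antisym)
    show "onorm_on V (\<lambda>x. x) \<le> 1" using V.nonempty by (intro onorm_on_le) auto
    show "1 \<le> onorm_on V (\<lambda>x. x)"
      using V.unit_vector_exists norm_le_onorm_on[OF calculation(2)] by force
  qed
  ultimately show ?thesis
    unfolding numerical_index_def[of s V] by (intro cInf_greatest) auto
qed

section \<open>Spaces of operators and functionals\<close>

context normed_space_over
begin

lemma bounded_linear_scale: "bounded_linear (scale c)"
proof -
  have "scale c (r *\<^sub>R y) = r *\<^sub>R scale c y" for r y
    by (metis scale_left_commute scale_of_real)
  then show ?thesis
    by (intro bounded_linear_intro[where K = "norm c"])
      (auto simp: scale_right_distrib norm_scale mult.commute)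
qed

lemma subspace_closure:
  assumes "subspace V"
  shows "subspace (closure V)"
proof (rule subspaceI)
  show "0 \<in> closure V" using subspace_0[OF assms] closure_subset by blast
  fix x y assume "x \<in> closure V" "y \<in> closure V"
  then obtain a b where "\<And>n. a n \<in> V" "a \<longlonglongrightarrow> x" "\<And>n. b n \<in> V" "b \<longlonglongrightarrow> y"
    by (metis closure_sequential)
  then have "\<And>n. a n + b n \<in> V" "(\<lambda>n. a n + b n) \<longlonglongrightarrow> x + y"
    by (auto intro: subspace_add[OF assms] tendsto_add)
  then show "x + y \<in> closure V" unfolding closure_sequential by (intro exI conjI allI)
next
  fix c x assume "x \<in> closure V"
  then have "scale c x \<in> closure (scale c ` V)"
    using closure_bounded_linear_image_subset[OF bounded_linear_scale] by blast
  moreover have "scale c ` V \<subseteq> V" using subspace_scale[OF assms] by blast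
  ultimately show "scale c x \<in> closure V" using closure_mono by blast
qed

lemma norm_op_scale: "norm (op_scale scale c T) = norm c * norm T"
proof (rule antisym)
  have le: "norm (op_scale scale c T) \<le> norm c * norm T" for c and T :: "'b::real_normed_vector \<Rightarrow>\<^sub>L 'a"
    by (rule norm_blinfun_bound)
      (auto simp: blinfun_apply_op_scale norm_scale mult.assoc norm_blinfun mult_left_mono)
  show "norm (op_scale scale c T) \<le> norm c * norm T" by (rule le)
  show "norm c * norm T \<le> norm (op_scale scale c T)"
  proof (cases "c = 0")
    case False
    then have "T = op_scale scale (inverse c) (op_scale scale c T)"
      by (intro blinfun_eqI) (simp add: blinfun_apply_op_scale)
    then have "norm T \<le> norm (inverse c) * norm (op_scale scale c T)"
      using le[of "inverse c" "op_scale scale c T"] by simp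
    then show ?thesis using False by (simp add: norm_divide field_simps)
  qed simp
qed

lemma normed_space_over_op_scale:
  "normed_space_over (op_scale scale :: 'k \<Rightarrow> ('b::real_normed_vector \<Rightarrow>\<^sub>L 'a) \<Rightarrow> 'b \<Rightarrow>\<^sub>L 'a)"
  by unfold_locales
    (auto simp: blinfun_apply_op_scale scale_right_distrib scale_left_distrib blinfun.add_left
      blinfun.scaleR_left scale_of_real norm_op_scale intro!: blinfun_eqI)

text \<open>
  Induction on \<open>B\<close> avoids the question whether \<open>span B\<close> is closed. Let \<open>a\<close> be a new element outside
  \<open>span B\<close>. If \<open>g\<close> and \<open>h\<close> vanish on \<open>span B\<close>, with value \<open>1\<close> at \<open>a\<close> and at \<open>b - g(b) a\<close> respectively,
  then \<open>h - h(a) g\<close> vanishes at \<open>a\<close> as well, and its value at \<open>b\<close> is \<open>h (b - g(b) a) = 1\<close>.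
\<close>

lemma separating_functional:
  assumes "finite B" "b \<notin> span B"
  obtains g where "g \<in> dual_space scale" "\<And>x. x \<in> span B \<Longrightarrow> blinfun_apply g x = 0"
    "blinfun_apply g b = 1"
proof -
  note mem = mem_linear_ops[OF normed_space_over_axioms normed_space_over_times, folded dual_space_def]
  interpret k: normed_space_over "(*) :: 'k \<Rightarrow> 'k \<Rightarrow> 'k" by (rule normed_space_over_times)
  have vanish: "blinfun_apply g x = 0"
    if "g \<in> dual_space scale" "\<And>x. x \<in> B \<Longrightarrow> blinfun_apply g x = 0" "x \<in> span B" for g B x
  proof -
    have "subspace {x. blinfun_apply g x = 0}"
      using that(1) by (auto simp: mem blinfun.add_right intro!: subspaceI)
    then show ?thesis using span_minimal[of B "{x. blinfun_apply g x = 0}"] that by blast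
  qed
  have "\<exists>g\<in>dual_space scale. (\<forall>x\<in>B. blinfun_apply g x = 0) \<and> blinfun_apply g b = 1"
    using assms
  proof (induction B arbitrary: b rule: finite_induct)
    case empty
    then have b: "b \<noteq> 0" by simp
    obtain f where f: "f \<in> dual_space scale" "blinfun_apply f b = of_real (norm b)"
      using norming_functional by blast
    have "op_scale (*) (inverse (of_real (norm b))) f \<in> dual_space scale"
      using f(1) by (simp add: mem k.blinfun_apply_op_scale)
    then show ?case
      using b f(2) by (intro bexI[rotated]) (auto simp: k.blinfun_apply_op_scale)
  next
    case (insert a B)
    then have b: "b \<notin> span B" using span_mono[of B "insert a B"] by blast
    show ?case
    proof (cases "a \<in> span B")
      case True
      then show ?thesis using insert.IH[OF b] vanish by blast
    next
      case False
      then obtain g where g: "g \<in> dual_space scale" "\<forall>x\<in>B. blinfun_apply g x = 0"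
        "blinfun_apply g a = 1" using insert.IH by blast
      define b' where "b' = b - scale (blinfun_apply g b) a"
      have "b' \<notin> span B" using insert.prems by (auto simp: b'_def span_breakdown_eq)
      then obtain h where h: "h \<in> dual_space scale" "\<forall>x\<in>B. blinfun_apply h x = 0"
        "blinfun_apply h b' = 1" using insert.IH by blast
      define f where "f = h - op_scale (*) (blinfun_apply h a) g"
      have f: "blinfun_apply f x = blinfun_apply h x - blinfun_apply h a * blinfun_apply g x" for x
        by (simp add: f_def blinfun.diff_left k.blinfun_apply_op_scale)
      have "f \<in> dual_space scale" using g(1) h(1) by (simp add: mem f algebra_simps)
      moreover have "blinfun_apply f b = 1"
        using h(1,3) by (simp add: f b'_def mem blinfun.diff_right mult.commute)
      ultimately show ?thesis using g h by (intro bexI[of _ f]) (auto simp: f)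
    qed
  qed
  then show thesis using that vanish by blast
qed

end

text \<open>Usually written \<open>f \<otimes> y\<close>.\<close>

definition rank_one ::
  "('k::real_or_complex \<Rightarrow> 'b::real_normed_vector \<Rightarrow> 'b) \<Rightarrow>
   ('a::real_normed_vector \<Rightarrow>\<^sub>L 'k) \<Rightarrow> 'b \<Rightarrow> ('a \<Rightarrow>\<^sub>L 'b)" where
  "rank_one t f y = Blinfun (\<lambda>x. t (blinfun_apply f x) y)"

context normed_space_over
begin

lemma blinfun_apply_rank_one: "blinfun_apply (rank_one scale f y) x = scale (blinfun_apply f x) y"
proof -
  have "bounded_linear (\<lambda>x. scale (blinfun_apply f x) y)"
  proof (rule bounded_linear_intro[where K = "norm f * norm y"])
    show "scale (blinfun_apply f (r *\<^sub>R x)) y = r *\<^sub>R scale (blinfun_apply f x) y" for r x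
      by (simp add: blinfun.scaleR_right scaleR_conv_of_real flip: scale_scale scale_of_real)
    show "norm (scale (blinfun_apply f x) y) \<le> norm x * (norm f * norm y)" for x
      using mult_right_mono[OF norm_blinfun[of f x] norm_ge_zero[of y]]
      by (simp add: norm_scale mult_ac)
  qed (simp add: blinfun.add_right scale_left_distrib)
  then show ?thesis by (simp add: rank_one_def bounded_linear_Blinfun_apply)
qed

lemma norm_rank_one: "norm (rank_one scale f y) = norm f * norm y"
proof (rule antisym)
  show "norm (rank_one scale f y) \<le> norm f * norm y"
  proof (rule norm_blinfun_bound)
    show "norm (blinfun_apply (rank_one scale f y) x) \<le> norm f * norm y * norm x" for x
      using mult_right_mono[OF norm_blinfun[of f x] norm_ge_zero[of y]]
      by (simp add: blinfun_apply_rank_one norm_scale mult_ac)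
  qed simp
  show "norm f * norm y \<le> norm (rank_one scale f y)"
  proof (cases "y = 0")
    case False
    have "norm f \<le> norm (rank_one scale f y) / norm y"
    proof (rule norm_blinfun_bound)
      show "norm (blinfun_apply f x) \<le> norm (rank_one scale f y) / norm y * norm x" for x
        using norm_blinfun[of "rank_one scale f y" x] False
        by (simp add: blinfun_apply_rank_one norm_scale field_simps)
    qed simp
    then show ?thesis using False by (simp add: field_simps)
  qed simp
qed

end

section \<open>Finite-rank and approximable operators\<close>

locale operator_spaces = X: normed_space_over sX + Y: normed_space_over sY
  for sX :: "'k::real_or_complex \<Rightarrow> 'x::real_normed_vector \<Rightarrow> 'x"
    and sY :: "'k \<Rightarrow> 'y::banach \<Rightarrow> 'y"
begin

sublocale K: normed_space_over "(*) :: 'k \<Rightarrow> 'k \<Rightarrow> 'k"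
  by (rule normed_space_over_times)

sublocale Ops: normed_space_over "op_scale sY :: 'k \<Rightarrow> ('x \<Rightarrow>\<^sub>L 'y) \<Rightarrow> ('x \<Rightarrow>\<^sub>L 'y)"
  by (rule Y.normed_space_over_op_scale)

sublocale X': normed_space_over "op_scale (*) :: 'k \<Rightarrow> ('x \<Rightarrow>\<^sub>L 'k) \<Rightarrow> ('x \<Rightarrow>\<^sub>L 'k)"
  by (rule K.normed_space_over_op_scale)

lemmas mem_ops = mem_linear_ops[OF X.normed_space_over_axioms Y.normed_space_over_axioms]
lemmas mem_dual_X =
  mem_linear_ops[OF X.normed_space_over_axioms K.normed_space_over_axioms, folded dual_space_def]
lemmas mem_dual_Y =
  mem_linear_ops[OF Y.normed_space_over_axioms K.normed_space_over_axioms, folded dual_space_def]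

lemma subspace_dual: "X'.subspace (dual_space sX)"
  by (rule X'.subspaceI)
    (auto simp: mem_dual_X blinfun.add_left K.blinfun_apply_op_scale algebra_simps)

lemma closed_linear_ops: "closed (linear_ops sX sY)"
proof -
  have "linear_ops sX sY =
      (\<Inter>c. \<Inter>x. {T. blinfun_apply T (sX c x) = sY c (blinfun_apply T x)})"
    by (auto simp: mem_ops)
  moreover have "continuous_on UNIV (\<lambda>T. sY c (blinfun_apply T x))" for c x
    by (intro bounded_linear.continuous_on[OF Y.bounded_linear_scale] continuous_intros)
  ultimately show ?thesis
    by (auto intro!: closed_INT closed_Collect_eq continuous_intros)
qed

abbreviation "FR \<equiv> finite_rank_ops sX sY"
abbreviation "Appr \<equiv> approximable_ops sX sY"

lemma subspace_finite_rank: "Ops.subspace FR"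
proof (rule Ops.subspaceI)
  show "0 \<in> FR"
    by (auto simp: finite_rank_ops_def mem_ops intro!: exI[of _ "{}"])
  fix T U assume "T \<in> FR" "U \<in> FR"
  then obtain B C where TU: "T \<in> linear_ops sX sY" "U \<in> linear_ops sX sY" "finite B" "finite C"
    "range (blinfun_apply T) \<subseteq> Y.span B" "range (blinfun_apply U) \<subseteq> Y.span C"
    by (auto simp: finite_rank_ops_def)
  have "blinfun_apply (T + U) x \<in> Y.span (B \<union> C)" for x
    unfolding blinfun.add_left
    using TU(5,6) Y.span_mono[of B "B \<union> C"] Y.span_mono[of C "B \<union> C"] by (blast intro: Y.span_add)
  moreover have "T + U \<in> linear_ops sX sY"
    using TU(1,2) by (simp add: mem_ops blinfun.add_left Y.scale_right_distrib)
  ultimately show "T + U \<in> FR"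
    using TU(3,4) by (auto simp: finite_rank_ops_def intro!: exI[of _ "B \<union> C"])
next
  fix c T assume "T \<in> FR"
  then show "op_scale sY c T \<in> FR"
    by (auto simp: finite_rank_ops_def mem_ops Y.blinfun_apply_op_scale Y.span_scale
        Y.scale_left_commute image_subset_iff mult.commute)
qed

lemma approximable_subset: "Appr \<subseteq> linear_ops sX sY"
  unfolding approximable_ops_def
  by (intro closure_minimal closed_linear_ops) (auto simp: finite_rank_ops_def)

lemma subspace_approximable: "Ops.subspace Appr"
  unfolding approximable_ops_def by (intro Ops.subspace_closure subspace_finite_rank)

lemma rank_one_finite_rank:
  assumes "f \<in> dual_space sX"
  shows "rank_one sY f y \<in> FR"
  using assms
  by (auto simp: finite_rank_ops_def mem_ops mem_dual_X Y.blinfun_apply_rank_one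
      intro!: exI[of _ "{y}"] Y.span_scale[OF Y.span_base])

lemma rank_one_approximable: "f \<in> dual_space sX \<Longrightarrow> rank_one sY f y \<in> Appr"
  unfolding approximable_ops_def using rank_one_finite_rank closure_subset by blast

lemma compose_dual: "g \<in> dual_space sY \<Longrightarrow> T \<in> linear_ops sX sY \<Longrightarrow> g o\<^sub>L T \<in> dual_space sX"
  by (simp add: mem_dual_X mem_dual_Y mem_ops)

text \<open>
  Finite-rank operators are sums of rank-one operators with bounded functionals: if the range of \<open>T\<close>
  lies in \<open>span (insert b B)\<close> and \<open>g\<close> vanishes on \<open>B\<close> with \<open>g b = 1\<close>, then \<open>g \<circ> T\<close> is the coefficient
  of \<open>b\<close>, and subtracting \<open>(g \<circ> T) \<otimes> b\<close> leaves an operator with range in \<open>span B\<close>.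
\<close>

lemma finite_rank_induct [consumes 1, case_names rank_one add]:
  assumes "T \<in> FR"
    and rank_one: "\<And>f y. f \<in> dual_space sX \<Longrightarrow> P (rank_one sY f y)"
    and add: "\<And>T U. P T \<Longrightarrow> P U \<Longrightarrow> P (T + U)"
  shows "P T"
proof -
  obtain B where "finite B" "range (blinfun_apply T) \<subseteq> Y.span B" "T \<in> linear_ops sX sY"
    using assms(1) by (auto simp: finite_rank_ops_def)
  then show ?thesis
  proof (induction B arbitrary: T rule: finite_induct)
    case empty
    then have "T = rank_one sY 0 0"
      by (intro blinfun_eqI) (auto simp: Y.blinfun_apply_rank_one)
    then show ?case by (simp add: rank_one X'.subspace_0[OF subspace_dual])
  next
    case (insert b B)
    show ?case
    proof (cases "b \<in> Y.span B")
      case True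
      then show ?thesis using insert by (simp add: Y.span_redundant)
    next
      case False
      then obtain g where g: "g \<in> dual_space sY"
        "\<And>y. y \<in> Y.span B \<Longrightarrow> blinfun_apply g y = 0" "blinfun_apply g b = 1"
        using Y.separating_functional[OF insert.hyps(1)] by metis
      define f where "f = g o\<^sub>L T"
      have f: "f \<in> dual_space sX" unfolding f_def using g(1) insert.prems(2) by (rule compose_dual)
      define U where "U = T - rank_one sY f b"
      have "blinfun_apply U x \<in> Y.span B" for x
      proof -
        have "blinfun_apply T x \<in> Y.span (insert b B)" using insert.prems(1) by blast
        then obtain k where k: "blinfun_apply T x - sY k b \<in> Y.span B"
          unfolding Y.span_breakdown_eq by blast
        have "blinfun_apply g (blinfun_apply T x - sY k b) = 0" using k by (rule g(2))
        then have "blinfun_apply f x = k"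
          using g(1,3) by (simp add: f_def blinfun.diff_right mem_dual_Y)
        with k show ?thesis by (simp add: U_def blinfun.diff_left Y.blinfun_apply_rank_one)
      qed
      moreover have "U \<in> linear_ops sX sY"
        using insert.prems(2) f
        by (simp add: U_def mem_ops mem_dual_X blinfun.diff_left Y.blinfun_apply_rank_one
            Y.scale_right_diff_distrib)
      ultimately have "P U" by (intro insert.IH) auto
      then have "P (U + rank_one sY f b)" using rank_one[OF f] by (rule add)
      then show ?thesis by (simp add: U_def)
    qed
  qed
qed

lemma normed_subspace_codomain:
  "\<exists>y::'y. y \<noteq> 0 \<Longrightarrow> normed_subspace sY UNIV"
  by unfold_locales auto

lemma unit_functional_exists:
  assumes "\<exists>x::'x. x \<noteq> 0"
  obtains f where "f \<in> dual_space sX" "norm f = 1"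
proof -
  obtain x :: 'x where x: "x \<noteq> 0" using assms by blast
  obtain f where f: "f \<in> dual_space sX" "norm f \<le> 1" "blinfun_apply f x = of_real (norm x)"
    using X.norming_functional by blast
  have "norm f \<ge> 1" using norm_blinfun[of f x] f(3) x by simp
  with f show thesis by (intro that[of f]) auto
qed

lemma unit_vector_codomain_exists:
  assumes "\<exists>y::'y. y \<noteq> 0"
  obtains y :: 'y where "norm y = 1"
  using normed_subspace.unit_vector_exists[OF normed_subspace_codomain[OF assms]] by blast

lemma normed_subspace_dual:
  assumes "\<exists>x::'x. x \<noteq> 0"
  shows "normed_subspace (op_scale (*)) (dual_space sX)"
proof -
  obtain f where "f \<in> dual_space sX" "norm f = 1"
    using unit_functional_exists[OF assms] .
  then have "\<exists>f\<in>dual_space sX. f \<noteq> 0" by (intro bexI[of _ f]) auto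
  then show ?thesis
    by unfold_locales (auto intro: subspace_dual)
qed

lemma normed_subspace_approximable:
  assumes "\<exists>x::'x. x \<noteq> 0" "\<exists>y::'y. y \<noteq> 0"
  shows "normed_subspace (op_scale sY) Appr"
proof -
  obtain f where f: "f \<in> dual_space sX" "norm f = 1"
    using unit_functional_exists[OF assms(1)] .
  obtain y :: 'y where y: "norm y = 1" using unit_vector_codomain_exists[OF assms(2)] .
  have "norm (rank_one sY f y) = 1" by (simp add: Y.norm_rank_one f y)
  then have "rank_one sY f y \<noteq> 0" by auto
  then show ?thesis
    using rank_one_approximable[OF f(1)] by unfold_locales (auto intro: subspace_approximable)
qed

lemma compose_approximable:
  assumes S: "S \<in> linear_ops sY sY" and T: "T \<in> Appr"
  shows "S o\<^sub>L T \<in> Appr"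
proof -
  have "blinfun_apply S (sY c y) = sY c (blinfun_apply S y)" for c y
    using S by (simp add: mem_linear_ops[OF Y.normed_space_over_axioms Y.normed_space_over_axioms])
  then have S_rank_one: "S o\<^sub>L rank_one sY f y = rank_one sY f (blinfun_apply S y)"
    for f :: "'x \<Rightarrow>\<^sub>L 'k" and y
    by (intro blinfun_eqI) (simp add: Y.blinfun_apply_rank_one)
  have "S o\<^sub>L U \<in> FR" if "U \<in> FR" for U
    using that
  proof (induction rule: finite_rank_induct)
    case (rank_one f y)
    then show ?case by (simp add: S_rank_one rank_one_finite_rank)
  next
    case (add T U)
    then show ?case
      by (simp add: bounded_bilinear.add_right[OF bounded_bilinear_blinfun_compose]
          Ops.subspace_add[OF subspace_finite_rank])
  qed
  then have "(\<lambda>U. S o\<^sub>L U) ` FR \<subseteq> FR" by blast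
  then have "closure ((\<lambda>U. S o\<^sub>L U) ` FR) \<subseteq> Appr"
    unfolding approximable_ops_def by (rule closure_mono)
  moreover have "(\<lambda>U. S o\<^sub>L U) ` closure FR \<subseteq> closure ((\<lambda>U. S o\<^sub>L U) ` FR)"
    by (intro closure_bounded_linear_image_subset
        bounded_bilinear.bounded_linear_right[OF bounded_bilinear_blinfun_compose])
  ultimately show ?thesis using T unfolding approximable_ops_def by blast
qed

text \<open>
  Composition \<open>T \<mapsto> S \<circ> T\<close> transfers operators from \<open>Y\<close> to \<open>A(X,Y)\<close>: the bound
  \<open>\<parallel>a y + c S y\<parallel> \<le> K \<parallel>y\<parallel>\<close> is applied at \<open>y = T x\<close>. A vector \<open>y\<close> is represented by \<open>f \<otimes> y\<close> with a
  functional \<open>f\<close> of norm one, which is sent to \<open>f \<otimes> S y\<close>.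
\<close>

lemma numerical_index_approximable_le_codomain:
  assumes X: "\<exists>x::'x. x \<noteq> 0" and Y: "\<exists>y::'y. y \<noteq> 0"
  shows "numerical_index (op_scale sY) Appr \<le> numerical_index sY UNIV"
proof (rule numerical_index_le_transfer)
  show "normed_subspace sY UNIV" using Y by (rule normed_subspace_codomain)
  show "normed_subspace (op_scale sY) Appr" using X Y by (rule normed_subspace_approximable)
  fix S :: "'y \<Rightarrow> 'y" assume S: "bounded_linear_on sY UNIV sY UNIV S"
  have "\<exists>B. \<forall>y. norm (S y) \<le> B * norm y" using S by (simp add: bounded_linear_on_def)
  then obtain B where "\<And>y. norm (S y) \<le> B * norm y" by blast
  moreover have "S (y + z) = S y + S z" "S (sY c y) = sY c (S y)" for c y z
    using S by (simp_all add: bounded_linear_on_def)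
  ultimately obtain S' where S': "S' \<in> linear_ops sY sY" "blinfun_apply S' = S"
    using linear_op_exists[OF Y.normed_space_over_axioms Y.normed_space_over_axioms] by metis
  let ?\<Phi> = "\<lambda>T. S' o\<^sub>L T"
  show "\<exists>\<Phi>. bounded_linear_on (op_scale sY) Appr (op_scale sY) Appr \<Phi> \<and>
      (\<forall>a c K. (\<forall>y\<in>UNIV. norm (sY a y + sY c (S y)) \<le> K * norm y) \<longrightarrow>
        (\<forall>T\<in>Appr. norm (op_scale sY a T + op_scale sY c (\<Phi> T)) \<le> K * norm T)) \<and>
      (\<forall>y\<in>UNIV. \<exists>T\<in>Appr. norm T = norm y \<and> norm (\<Phi> T) = norm (S y))"
  proof (intro exI[of _ ?\<Phi>] conjI allI impI ballI)
    have S'_scale: "blinfun_apply S' (sY c y) = sY c (blinfun_apply S' y)" for c y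
      using S'(1) by (simp add: mem_linear_ops[OF Y.normed_space_over_axioms Y.normed_space_over_axioms])
    show "bounded_linear_on (op_scale sY) Appr (op_scale sY) Appr ?\<Phi>"
      unfolding bounded_linear_on_def
    proof (intro conjI ballI allI)
      show "?\<Phi> ` Appr \<subseteq> Appr" using compose_approximable[OF S'(1)] by blast
      show "?\<Phi> (T + U) = ?\<Phi> T + ?\<Phi> U" for T U
        by (rule bounded_bilinear.add_right[OF bounded_bilinear_blinfun_compose])
      show "?\<Phi> (op_scale sY c T) = op_scale sY c (?\<Phi> T)" for c T
        by (intro blinfun_eqI) (simp add: Y.blinfun_apply_op_scale S'_scale)
      show "\<exists>B. \<forall>T\<in>Appr. norm (?\<Phi> T) \<le> B * norm T"
        using norm_blinfun_compose by blast
    qed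
    show "norm (op_scale sY a T + op_scale sY c (?\<Phi> T)) \<le> K * norm T"
      if bound: "\<forall>y\<in>UNIV. norm (sY a y + sY c (S y)) \<le> K * norm y" for a c K T
    proof (rule norm_blinfun_bound)
      obtain y :: 'y where "norm y = 1" using unit_vector_codomain_exists[OF Y] .
      then have K: "0 \<le> K"
        using bound[rule_format, of y] norm_ge_zero order_trans by (metis UNIV_I mult.right_neutral)
      then show "0 \<le> K * norm T" by simp
      fix x
      have "norm (blinfun_apply (op_scale sY a T + op_scale sY c (?\<Phi> T)) x)
          \<le> K * norm (blinfun_apply T x)"
        using bound by (simp add: blinfun.add_left Y.blinfun_apply_op_scale S'(2))
      also have "\<dots> \<le> K * (norm T * norm x)" by (intro mult_left_mono norm_blinfun K)
      finally show "norm (blinfun_apply (op_scale sY a T + op_scale sY c (?\<Phi> T)) x)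
          \<le> K * norm T * norm x" by (simp add: mult.assoc)
    qed
    show "\<exists>T\<in>Appr. norm T = norm y \<and> norm (?\<Phi> T) = norm (S y)" for y
    proof -
      obtain f where f: "f \<in> dual_space sX" "norm f = 1" using unit_functional_exists[OF X] .
      have "?\<Phi> (rank_one sY f y) = rank_one sY f (S y)"
        by (intro blinfun_eqI) (simp add: Y.blinfun_apply_rank_one S'_scale flip: S'(2))
      then show ?thesis
        using rank_one_approximable[OF f(1), of y] f(2)
        by (intro bexI[of _ "rank_one sY f y"]) (auto simp: Y.norm_rank_one)
    qed
  qed
qed

end

section \<open>Operators on approximable operators induced from the dual of the domain\<close>

locale dual_operator = operator_spaces sX sY
  for sX :: "'k::real_or_complex \<Rightarrow> 'x::real_normed_vector \<Rightarrow> 'x"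
    and sY :: "'k \<Rightarrow> 'y::banach \<Rightarrow> 'y" +
  fixes S :: "('x \<Rightarrow>\<^sub>L 'k) \<Rightarrow> ('x \<Rightarrow>\<^sub>L 'k)"
  assumes S: "bounded_linear_on (op_scale (*)) (dual_space sX) (op_scale (*)) (dual_space sX) S"
    and X_nontrivial: "\<exists>x::'x. x \<noteq> 0"
begin

text \<open>
  The relation says that \<open>U* = S \<circ> T*\<close>. Treating it as a relation first makes linearity and the norm
  bound available before it is known that every \<open>T\<close> has a partner \<open>U\<close>.
\<close>

definition dual_lift :: "('x \<Rightarrow>\<^sub>L 'y) \<Rightarrow> ('x \<Rightarrow>\<^sub>L 'y) \<Rightarrow> bool" where
  "dual_lift T U \<longleftrightarrow> T \<in> Appr \<and> U \<in> Appr \<and> (\<forall>g\<in>dual_space sY. g o\<^sub>L U = S (g o\<^sub>L T))"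

lemma S_mem: "h \<in> dual_space sX \<Longrightarrow> S h \<in> dual_space sX"
  and S_add: "h \<in> dual_space sX \<Longrightarrow> h' \<in> dual_space sX \<Longrightarrow> S (h + h') = S h + S h'"
  and S_scale: "h \<in> dual_space sX \<Longrightarrow> S (op_scale (*) c h) = op_scale (*) c (S h)"
  using S by (auto simp: bounded_linear_on_def)

lemma S_diff:
  assumes "h \<in> dual_space sX" "h' \<in> dual_space sX"
  shows "S (h - h') = S h - S h'"
  using S_add[of "h - h'" h'] X'.subspace_diff[OF subspace_dual assms] assms by simp

lemma approximable_compose_dual: "g \<in> dual_space sY \<Longrightarrow> T \<in> Appr \<Longrightarrow> g o\<^sub>L T \<in> dual_space sX"
  using compose_dual approximable_subset by blast

lemma compose_op_scale:
  "g \<in> dual_space sY \<Longrightarrow> g o\<^sub>L op_scale sY c T = op_scale (*) c (g o\<^sub>L T)"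
  by (intro blinfun_eqI) (simp add: Y.blinfun_apply_op_scale K.blinfun_apply_op_scale mem_dual_Y)

lemma dual_lift_add:
  assumes "dual_lift T U" "dual_lift T' U'"
  shows "dual_lift (T + T') (U + U')"
  using assms
  by (auto simp: dual_lift_def Ops.subspace_add[OF subspace_approximable] S_add
      approximable_compose_dual bounded_bilinear.add_right[OF bounded_bilinear_blinfun_compose])

lemma dual_lift_diff:
  assumes "dual_lift T U" "dual_lift T' U'"
  shows "dual_lift (T - T') (U - U')"
  using assms
  by (auto simp: dual_lift_def Ops.subspace_diff[OF subspace_approximable] S_diff
      approximable_compose_dual bounded_bilinear.diff_right[OF bounded_bilinear_blinfun_compose])

lemma dual_lift_scale:
  assumes "dual_lift T U"
  shows "dual_lift (op_scale sY c T) (op_scale sY c U)"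
  using assms
  by (auto simp: dual_lift_def Ops.subspace_scale[OF subspace_approximable] compose_op_scale
      S_scale approximable_compose_dual)

lemma dual_lift_rank_one:
  assumes f: "f \<in> dual_space sX"
  shows "dual_lift (rank_one sY f y) (rank_one sY (S f) y)"
proof -
  have "g o\<^sub>L rank_one sY h y = op_scale (*) (blinfun_apply g y) h" if "g \<in> dual_space sY"
    for g and h :: "'x \<Rightarrow>\<^sub>L 'k"
    using that
    by (intro blinfun_eqI)
      (simp add: Y.blinfun_apply_rank_one K.blinfun_apply_op_scale mem_dual_Y mult.commute)
  then show ?thesis
    using f by (simp add: dual_lift_def rank_one_approximable S_mem S_scale)
qed

text \<open>
  For \<open>W = a T + c U\<close> and a functional \<open>g\<close> norming \<open>W x\<close>, the number \<open>\<parallel>W x\<parallel>\<close> is the value at \<open>x\<close> of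
  \<open>g \<circ> W = a h + c S h\<close> with \<open>h = g \<circ> T\<close>, and \<open>\<parallel>h\<parallel> \<le> \<parallel>T\<parallel>\<close>.
\<close>

lemma dual_lift_bound:
  assumes TU: "dual_lift T U"
    and K: "\<And>h. h \<in> dual_space sX \<Longrightarrow>
      norm (op_scale (*) a h + op_scale (*) c (S h)) \<le> K * norm h"
  shows "norm (op_scale sY a T + op_scale sY c U) \<le> K * norm T"
proof (rule norm_blinfun_bound)
  obtain f where "f \<in> dual_space sX" "norm f = 1" using unit_functional_exists[OF X_nontrivial] .
  then have K0: "0 \<le> K" using K[of f] norm_ge_zero order_trans by (metis mult.right_neutral)
  then show "0 \<le> K * norm T" by simp
  fix x
  let ?W = "op_scale sY a T + op_scale sY c U"
  obtain g where g: "g \<in> dual_space sY" "norm g \<le> 1"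
    "blinfun_apply g (blinfun_apply ?W x) = of_real (norm (blinfun_apply ?W x))"
    using Y.norming_functional by blast
  have gT: "g o\<^sub>L T \<in> dual_space sX" using TU g(1) by (simp add: dual_lift_def approximable_compose_dual)
  have gU: "g o\<^sub>L U = S (g o\<^sub>L T)" using TU g(1) by (simp add: dual_lift_def)
  have "norm (blinfun_apply ?W x) = norm (blinfun_apply (g o\<^sub>L ?W) x)" using g(3) by simp
  also have "g o\<^sub>L ?W = op_scale (*) a (g o\<^sub>L T) + op_scale (*) c (S (g o\<^sub>L T))"
    using g(1) by (simp add: bounded_bilinear.add_right[OF bounded_bilinear_blinfun_compose]
        compose_op_scale gU)
  also have "norm (blinfun_apply \<dots> x) \<le> K * norm (g o\<^sub>L T) * norm x"
    using norm_blinfun mult_right_mono[OF K[OF gT] norm_ge_zero] by (rule order_trans)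
  also have "\<dots> \<le> K * norm T * norm x"
  proof -
    have "norm (g o\<^sub>L T) \<le> norm g * norm T" by (rule norm_blinfun_compose)
    also have "\<dots> \<le> norm T" using mult_right_mono[OF g(2) norm_ge_zero[of T]] by simp
    finally show ?thesis using K0 by (intro mult_right_mono mult_left_mono) auto
  qed
  finally show "norm (blinfun_apply ?W x) \<le> K * norm T * norm x" .
qed

lemma dual_lift_norm_le:
  obtains B where "B \<ge> 0" "\<And>T U. dual_lift T U \<Longrightarrow> norm U \<le> B * norm T"
    "\<And>h. h \<in> dual_space sX \<Longrightarrow> norm (S h) \<le> B * norm h"
proof -
  obtain B where B: "B \<ge> 0" "\<And>h. h \<in> dual_space sX \<Longrightarrow> norm (S h) \<le> B * norm h"
    using bounded_linear_on_bound[OF S] by blast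
  have "norm U \<le> B * norm T" if "dual_lift T U" for T U
    using dual_lift_bound[OF that, of 0 1 B] B(2) by simp
  with B show thesis using that by blast
qed

lemma dual_lift_unique:
  assumes "dual_lift T U" "dual_lift T U'"
  shows "U = U'"
proof -
  obtain B where "\<And>T U. dual_lift T U \<Longrightarrow> norm U \<le> B * norm T"
    using dual_lift_norm_le by metis
  from this[OF dual_lift_diff[OF assms]] show ?thesis by simp
qed

lemma dual_lift_exists_finite_rank:
  assumes "T \<in> FR"
  shows "\<exists>U. dual_lift T U"
  using assms
  by (induction rule: finite_rank_induct) (blast intro: dual_lift_rank_one dual_lift_add)+

text \<open>
  If finite-rank operators \<open>t n\<close> converge to \<open>T\<close>, then by \<open>dual_lift_norm_le\<close>, applied to differences,
  their partners form a Cauchy sequence. Its limit exists because \<open>Y\<close> is complete, and the relation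
  passes to the limit because \<open>S\<close> is bounded.
\<close>

lemma dual_lift_exists:
  assumes T: "T \<in> Appr"
  shows "\<exists>U. dual_lift T U"
proof -
  obtain B where B: "B \<ge> 0" "\<And>T U. dual_lift T U \<Longrightarrow> norm U \<le> B * norm T"
    "\<And>h. h \<in> dual_space sX \<Longrightarrow> norm (S h) \<le> B * norm h"
    using dual_lift_norm_le by blast
  obtain t where t: "\<And>n. t n \<in> FR" "t \<longlonglongrightarrow> T"
    using T unfolding approximable_ops_def closure_sequential by blast
  then have "\<forall>n. \<exists>U. dual_lift (t n) U" using dual_lift_exists_finite_rank by blast
  then obtain u where u: "\<And>n. dual_lift (t n) (u n)" by metis
  have "Cauchy u"
  proof (rule CauchyI)
    fix e :: real assume "e > 0"
    then have "e / (B + 1) > 0" using B(1) by simp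
    then obtain M where M: "\<And>m n. m \<ge> M \<Longrightarrow> n \<ge> M \<Longrightarrow> norm (t m - t n) < e / (B + 1)"
      using LIMSEQ_imp_Cauchy[OF t(2)] unfolding Cauchy_iff by meson
    have "norm (u m - u n) < e" if "m \<ge> M" "n \<ge> M" for m n
    proof -
      have "norm (u m - u n) \<le> B * norm (t m - t n)" by (intro B(2) dual_lift_diff u)
      also have "\<dots> \<le> (B + 1) * norm (t m - t n)" by (intro mult_right_mono) auto
      also have "\<dots> < e" using M[OF that] B(1) by (simp add: field_simps)
      finally show ?thesis .
    qed
    then show "\<exists>M. \<forall>m\<ge>M. \<forall>n\<ge>M. norm (u m - u n) < e" by blast
  qed
  then obtain U where U: "u \<longlonglongrightarrow> U" using Cauchy_convergent_iff convergent_def by blast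
  have "U \<in> Appr"
    using closed_sequentially[OF _ _ U, of Appr] u
    by (auto simp: approximable_ops_def dual_lift_def)
  moreover have "g o\<^sub>L U = S (g o\<^sub>L T)" if g: "g \<in> dual_space sY" for g
  proof (rule LIMSEQ_unique)
    have lim: "(\<lambda>n. g o\<^sub>L v n) \<longlonglongrightarrow> (g o\<^sub>L V)" if "v \<longlonglongrightarrow> V"
      for v and V :: "'x \<Rightarrow>\<^sub>L 'y"
      using that by (intro bounded_bilinear.tendsto[OF bounded_bilinear_blinfun_compose]) auto
    show "(\<lambda>n. g o\<^sub>L u n) \<longlonglongrightarrow> (g o\<^sub>L U)" using U by (rule lim)
    have mem: "g o\<^sub>L t n \<in> dual_space sX" "g o\<^sub>L T \<in> dual_space sX" for n
      using u[of n] T g by (auto simp: dual_lift_def approximable_compose_dual)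
    have "(\<lambda>n. S (g o\<^sub>L t n) - S (g o\<^sub>L T)) \<longlonglongrightarrow> 0"
    proof (rule Lim_null_comparison)
      show "\<forall>\<^sub>F n in sequentially. norm (S (g o\<^sub>L t n) - S (g o\<^sub>L T)) \<le> B * norm ((g o\<^sub>L t n) - (g o\<^sub>L T))"
        using B(3) mem by (auto simp: X'.subspace_diff[OF subspace_dual] simp flip: S_diff)
      show "(\<lambda>n. B * norm ((g o\<^sub>L t n) - (g o\<^sub>L T))) \<longlonglongrightarrow> 0"
        using lim[OF t(2)] by (intro tendsto_mult_right_zero tendsto_norm_zero LIM_zero)
    qed
    moreover have "g o\<^sub>L u n = S (g o\<^sub>L t n)" for n using u g by (simp add: dual_lift_def)
    ultimately show "(\<lambda>n. g o\<^sub>L u n) \<longlonglongrightarrow> S (g o\<^sub>L T)" by (simp add: LIM_zero_iff)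
  qed
  ultimately show ?thesis using T by (auto simp: dual_lift_def)
qed

definition lifted :: "('x \<Rightarrow>\<^sub>L 'y) \<Rightarrow> ('x \<Rightarrow>\<^sub>L 'y)" where
  "lifted T = (THE U. dual_lift T U)"

lemma lifted_eq: "dual_lift T U \<Longrightarrow> lifted T = U"
  unfolding lifted_def using dual_lift_unique by blast

lemma dual_lift_lifted: "T \<in> Appr \<Longrightarrow> dual_lift T (lifted T)"
  using dual_lift_exists lifted_eq by metis

lemma bounded_linear_on_lifted:
  "bounded_linear_on (op_scale sY) Appr (op_scale sY) Appr lifted"
  unfolding bounded_linear_on_def
proof (intro conjI ballI allI)
  show "lifted ` Appr \<subseteq> Appr" using dual_lift_lifted by (auto simp: dual_lift_def)
  show "lifted (T + U) = lifted T + lifted U" if "T \<in> Appr" "U \<in> Appr" for T U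
    using that by (intro lifted_eq dual_lift_add dual_lift_lifted)
  show "lifted (op_scale sY c T) = op_scale sY c (lifted T)" if "T \<in> Appr" for c T
    using that by (intro lifted_eq dual_lift_scale dual_lift_lifted)
  show "\<exists>B. \<forall>T\<in>Appr. norm (lifted T) \<le> B * norm T"
    using dual_lift_norm_le dual_lift_lifted by metis
qed

end

section \<open>The numerical index of the approximable operators\<close>

lemma (in operator_spaces) numerical_index_approximable_le_dual:
  assumes X: "\<exists>x::'x. x \<noteq> 0" and Y: "\<exists>y::'y. y \<noteq> 0"
  shows "numerical_index (op_scale sY) Appr \<le> numerical_index (op_scale (*)) (dual_space sX)"
proof (rule numerical_index_le_transfer)
  show "normed_subspace (op_scale (*)) (dual_space sX)" using X by (rule normed_subspace_dual)
  show "normed_subspace (op_scale sY) Appr" using X Y by (rule normed_subspace_approximable)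
  fix S
  assume "bounded_linear_on (op_scale (*)) (dual_space sX) (op_scale (*)) (dual_space sX) S"
  then interpret dual_operator sX sY S by unfold_locales (use X in auto)
  show "\<exists>\<Phi>. bounded_linear_on (op_scale sY) Appr (op_scale sY) Appr \<Phi> \<and>
      (\<forall>a c K. (\<forall>h\<in>dual_space sX. norm (op_scale (*) a h + op_scale (*) c (S h)) \<le> K * norm h) \<longrightarrow>
        (\<forall>T\<in>Appr. norm (op_scale sY a T + op_scale sY c (\<Phi> T)) \<le> K * norm T)) \<and>
      (\<forall>h\<in>dual_space sX. \<exists>T\<in>Appr. norm T = norm h \<and> norm (\<Phi> T) = norm (S h))"
  proof (intro exI[of _ lifted] conjI allI impI ballI)
    show "bounded_linear_on (op_scale sY) Appr (op_scale sY) Appr lifted"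
      by (rule bounded_linear_on_lifted)
    show "norm (op_scale sY a T + op_scale sY c (lifted T)) \<le> K * norm T"
      if "\<forall>h\<in>dual_space sX. norm (op_scale (*) a h + op_scale (*) c (S h)) \<le> K * norm h"
        "T \<in> Appr" for a c K T
      using that by (intro dual_lift_bound dual_lift_lifted) auto
    show "\<exists>T\<in>Appr. norm T = norm h \<and> norm (lifted T) = norm (S h)" if h: "h \<in> dual_space sX" for h
    proof -
      obtain y :: 'y where "norm y = 1" using unit_vector_codomain_exists[OF Y] .
      then show ?thesis
        using rank_one_approximable[OF h, of y] lifted_eq[OF dual_lift_rank_one[OF h, of y]]
        by (intro bexI[of _ "rank_one sY h y"]) (auto simp: Y.norm_rank_one)
    qed
  qed
qed

theorem corollary3p6:
  fixes sX :: "'k::real_or_complex \<Rightarrow> 'x::banach \<Rightarrow> 'x"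
    and sY :: "'k \<Rightarrow> 'y::banach \<Rightarrow> 'y"
  assumes "normed_space_over sX" and "normed_space_over sY"
    and "\<exists>x::'x. x \<noteq> 0" and "\<exists>y::'y. y \<noteq> 0"
  shows "numerical_index (op_scale sY) (approximable_ops sX sY)
           \<le> min (numerical_index (op_scale (*)) (dual_space sX)) (numerical_index sY UNIV)"
proof -
  interpret operator_spaces sX sY
    using assms(1,2) by (rule operator_spaces.intro)
  show ?thesis
    using numerical_index_approximable_le_dual[OF assms(3,4)]
      numerical_index_approximable_le_codomain[OF assms(3,4)] by simp
qed

end
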